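(* For $t>0$ and $m\in\mathbb{Z}^{+}$ let $f(m)=t\ln\left(1+\frac{t}{m}\right)$. Let $0\le\sigma<1$. Then, as $t\to\infty$, $$\sum_{m=1}^{[t]}\frac{1}{m^{\sigma}}e^{if(m)}=\begin{cases}O\left(t^{\frac12-\frac23\sigma}\ln t\right), & 0\le\sigma\le\frac12,\\[2mm] O\left(t^{\frac13-\frac13\sigma}\ln t\right), & \frac12<\sigma<1.\end{cases}$$
   Context: $[A]$ denotes the integer part of $A$. The parameter $\sigma$ is fixed, and the $O$-statements are for real $t\to\infty$ (implied constants may depend on $\sigma$). *)

theory Defs
  imports "HOL-Analysis.Analysis" "HOL-Library.Landau_Symbols"
begin

definition phase :: "real \<Rightarrow> nat \<Rightarrow> real" where
  "phase t m = t * ln (1 + t / real m)"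

end

theory Submission
  imports Defs
begin

text \<open>
  On \<open>1 \<le> x \<le> 4 t\<close> the second derivative of the phase has size \<open>t / x\<^sup>2\<close> and the third has size
  \<open>t / x\<^sup>3\<close>, so van der Corput's second and third derivative tests bound the unweighted sum over a
  dyadic block starting at \<open>N\<close> by a constant times \<open>t powr (1/2)\<close> and, when \<open>N \<le> t powr (2/3)\<close>,
  by a constant times \<open>N powr (1/2) * t powr (1/6)\<close>. Partial summation brings in the factor
  \<open>N powr -\<sigma>\<close>. Using the trivial bound for \<open>N \<le> t powr (1/3)\<close>, the third derivative test up to
  \<open>t powr (2/3)\<close> and the second derivative test beyond, each of the \<open>O(ln t)\<close> dyadic blocks
  contributes at most a constant times the claimed power of \<open>t\<close>.

  Working with finite differences of sequences instead of derivatives makes the Weyl differencing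
  step purely algebraic.
\<close>

subsection \<open>The Kusmin--Landau inequality and the second difference test\<close>

text \<open>Amounts to \<open>x * cos x \<le> sin x\<close>: the difference of the two sides
  vanishes at 0 and has derivative \<open>- (x * sin x)\<close>, which is nonpositive up to
  pi.\<close>

lemma cot_le_inverse:
  fixes x :: real
  assumes "0 < x" "x < pi"
  shows "cot x \<le> 1 / x"
proof -
  have "0 * cos 0 - sin 0 \<ge> x * cos x - sin x"
  proof (rule DERIV_nonpos_imp_nonincreasing[where f = "\<lambda>y. y * cos y - sin y"])
    fix y assume y: "0 \<le> y" "y \<le> x"
    have "((\<lambda>y. y * cos y - sin y) has_real_derivative - (y * sin y)) (at y)"
      by (auto intro!: derivative_eq_intros)
    moreover have "- (y * sin y) \<le> 0"
      using y assms by (simp add: sin_ge_zero)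
    ultimately show "\<exists>d. ((\<lambda>y. y * cos y - sin y) has_real_derivative d) (at y) \<and> d \<le> 0"
      by blast
  qed (use assms in simp)
  moreover have "sin x > 0"
    using assms by (simp add: sin_gt_zero)
  ultimately show ?thesis
    using assms by (simp add: cot_def field_simps)
qed

text \<open>Follows from \<open>cot x - cot y = sin (y - x) / (sin x * sin y)\<close>.\<close>

lemma cot_antimono:
  fixes x y :: real
  assumes "0 < x" "x \<le> y" "y < pi"
  shows "cot y \<le> cot x"
proof -
  have "sin x > 0" "sin y > 0"
    using assms by (auto intro: sin_gt_zero)
  moreover have "sin (y - x) \<ge> 0"
    using assms by (intro sin_ge_zero) auto
  ultimately show ?thesis
    by (simp add: cot_def field_simps sin_diff)
qed

lemma abs_cot_le:
  fixes x \<theta> :: real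
  assumes "0 < \<theta>" "\<theta> \<le> x" "x \<le> pi - \<theta>"
  shows "\<bar>cot x\<bar> \<le> 1 / \<theta>"
proof -
  have "cot x \<le> cot \<theta>" "cot (pi - x) \<le> cot \<theta>"
    using assms by (auto intro!: cot_antimono)
  moreover have "cot (pi - x) = - cot x"
    by (simp add: cot_def)
  moreover have "cot \<theta> \<le> 1 / \<theta>"
    using assms by (intro cot_le_inverse) auto
  ultimately show ?thesis by linarith
qed

text \<open>An explicit inverse of \<open>1 - cis x\<close>. Its real part is constantly 1/2, so
  along a varying \<open>x\<close> only the monotone cotangent contributes to the variation.\<close>

lemma one_minus_cis_times_cot:
  assumes "0 < x" "x < 2 * pi"
  shows "Complex (1/2) (cot (x/2) / 2) * (1 - cis x) = 1"
proof -
  define y where "y = x / 2"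
  have x: "x = 2 * y" and "sin y > 0"
    using assms by (auto simp: y_def intro!: sin_gt_zero)
  have "1 - cis x = Complex (2 * (sin y)\<^sup>2) (- 2 * sin y * cos y)"
    unfolding x by (simp add: complex_eq_iff cos_double_sin sin_double)
  also have "Complex (1/2) (cot (x/2) / 2) * \<dots> = Complex ((sin y)\<^sup>2 + (cos y)\<^sup>2) 0"
    using \<open>sin y > 0\<close> unfolding x by (simp add: complex_eq_iff cot_def power2_eq_square)
  finally show ?thesis by (simp add: complex_eq_iff)
qed

text \<open>The first differences stay at distance \<open>\<theta>\<close> from multiples of 2 pi,
  so each term is a bounded factor \<open>g n\<close> times the difference
  \<open>cis (f n) - cis (f (Suc n))\<close>. After summation by parts, the boundary values and the
  total variation of \<open>g\<close> are all of order \<open>1 / \<theta>\<close>.\<close>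

theorem kusmin_landau:
  fixes f :: "nat \<Rightarrow> real"
  assumes \<theta>: "0 < \<theta>"
    and mono: "\<And>n. a \<le> n \<Longrightarrow> Suc n < b \<Longrightarrow> f (Suc n) - f n \<le> f (Suc (Suc n)) - f (Suc n)"
    and lo: "\<And>n. a \<le> n \<Longrightarrow> n < b \<Longrightarrow> \<theta> \<le> f (Suc n) - f n"
    and hi: "\<And>n. a \<le> n \<Longrightarrow> n < b \<Longrightarrow> f (Suc n) - f n \<le> 2 * pi - \<theta>"
  shows "norm (\<Sum>n=a..<b. cis (f n)) \<le> 12 / \<theta>"
proof (cases "a < b")
  case False
  then show ?thesis using \<theta> by simp
next
  case True
  define c where "c n = cot ((f (Suc n) - f n) / 2)" for n
  define g where "g n = Complex (1/2) (c n / 2)" for n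
  have g: "cis (f n) = g n * cis (f n) - g n * cis (f (Suc n))" if "a \<le> n" "n < b" for n
  proof -
    have "g n * (1 - cis (f (Suc n) - f n)) = 1"
      unfolding g_def c_def using lo[OF that] hi[OF that] \<theta>
      by (intro one_minus_cis_times_cot) auto
    then have "cis (f n) = g n * (1 - cis (f (Suc n) - f n)) * cis (f n)"
      by simp
    also have "\<dots> = g n * (cis (f n) - cis (f (Suc n) - f n) * cis (f n))"
      by (simp add: algebra_simps)
    also have "\<dots> = g n * (cis (f n) - cis (f (Suc n)))"
      by (simp add: cis_mult)
    finally show ?thesis
      by (simp add: algebra_simps)
  qed
  \<comment> \<open>Summation by parts; the total variation of \<open>g\<close> telescopes because \<open>cot\<close> is monotone.\<close>
  have parts: "norm ((\<Sum>n=a..<Suc m. cis (f n)) + g m * cis (f (Suc m)))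
          \<le> norm (g a) + (c a - c m) / 2" if "a \<le> m" "m < b" for m
    using that
  proof (induction m rule: dec_induct)
    case base
    have "cis (f a) + g a * cis (f (Suc a)) = g a * cis (f a)"
      using g[of a] True by (simp add: algebra_simps)
    then show ?case by (simp add: norm_mult)
  next
    case (step m)
    have "c (Suc m) \<le> c m"
      unfolding c_def using step.hyps step.prems mono[of m] lo[of m] hi[of "Suc m"] \<theta>
      by (intro cot_antimono) auto
    moreover have "g (Suc m) - g m = \<i> * complex_of_real ((c (Suc m) - c m) / 2)"
      by (simp add: g_def complex_eq_iff field_simps)
    ultimately have d: "norm (g (Suc m) - g m) = (c m - c (Suc m)) / 2"
      by (simp only: norm_mult norm_of_real) simp
    have "(\<Sum>n=a..<Suc (Suc m). cis (f n)) + g (Suc m) * cis (f (Suc (Suc m)))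
        = (\<Sum>n=a..<Suc m. cis (f n)) + (cis (f (Suc m)) + g (Suc m) * cis (f (Suc (Suc m))))"
      using step.hyps by (simp add: add.assoc)
    also have "cis (f (Suc m)) + g (Suc m) * cis (f (Suc (Suc m))) = g (Suc m) * cis (f (Suc m))"
      using g[of "Suc m"] step by (simp add: algebra_simps)
    also have "(\<Sum>n=a..<Suc m. cis (f n)) + \<dots> =
        ((\<Sum>n=a..<Suc m. cis (f n)) + g m * cis (f (Suc m))) + (g (Suc m) - g m) * cis (f (Suc m))"
      by (simp add: algebra_simps)
    finally have "norm ((\<Sum>n=a..<Suc (Suc m). cis (f n)) + g (Suc m) * cis (f (Suc (Suc m))))
       \<le> norm ((\<Sum>n=a..<Suc m. cis (f n)) + g m * cis (f (Suc m))) + norm ((g (Suc m) - g m) * cis (f (Suc m)))"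
      using norm_triangle_ineq by metis
    also have "norm ((g (Suc m) - g m) * cis (f (Suc m))) = (c m - c (Suc m)) / 2"
      by (simp only: norm_mult norm_cis d mult_1_right)
    finally show ?case
      using step.IH step.prems by (simp add: diff_divide_distrib del: sum.op_ivl_Suc)
  qed
  define K where "K = 1 / \<theta>"
  have c: "\<bar>c n\<bar> \<le> 2 * K" if "a \<le> n" "n < b" for n
    unfolding c_def K_def
    using abs_cot_le[of "\<theta>/2" "(f (Suc n) - f n) / 2"] lo[OF that] hi[OF that] \<theta> by simp
  \<comment> \<open>A single admissible difference forces
    \<open>\<theta> \<le> 2 * pi - \<theta>\<close>. The resulting \<open>1 \<le> 4 * K\<close>
    absorbs the constant real part 1/2 of \<open>g\<close> into a multiple of
    \<open>K\<close>.\<close>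
  have "\<theta> \<le> pi"
    using lo[of a] hi[of a] True by simp
  then have "1 \<le> 4 * K"
    using pi_less_4 \<theta> by (simp add: K_def field_simps)
  have ng: "norm (g n) \<le> 3 * K" if "a \<le> n" "n < b" for n
  proof -
    have "norm (g n) \<le> 1/2 + \<bar>c n\<bar> / 2"
      using cmod_le[of "g n"] by (simp add: g_def)
    then show ?thesis using c[OF that] \<open>1 \<le> 4 * K\<close> by linarith
  qed
  obtain m where m: "b = Suc m"
    using True by (cases b) auto
  then have "norm (\<Sum>n=a..<b. cis (f n)) \<le> norm (g a) + (c a - c m) / 2 + norm (g m * cis (f (Suc m)))"
    using parts[of m] True
      norm_triangle_ineq4[of "(\<Sum>n=a..<Suc m. cis (f n)) + g m * cis (f (Suc m))" "g m * cis (f (Suc m))"]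
    by simp
  also have "norm (g m * cis (f (Suc m))) = norm (g m)"
    by (simp add: norm_mult)
  also have "norm (g a) + (c a - c m) / 2 + norm (g m) \<le> 12 * K"
    using ng[of a] ng[of m] c[of a] c[of m] m True \<open>1 \<le> 4 * K\<close> by (simp add: abs_le_iff field_simps)
  finally show ?thesis
    by (simp add: K_def)
qed

text \<open>Used to cut an index range according to the size of the first differences. The value
  \<open>m = b\<close> covers the case that the level \<open>c\<close> is never reached.\<close>

lemma mono_threshold:
  fixes d :: "nat \<Rightarrow> real"
  assumes "a \<le> b" and mono: "\<And>n. a \<le> n \<Longrightarrow> Suc n < b \<Longrightarrow> d n \<le> d (Suc n)"
  obtains m where "a \<le> m" "m \<le> b" "\<And>n. a \<le> n \<Longrightarrow> n < m \<Longrightarrow> d n < c"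
    "\<And>n. m \<le> n \<Longrightarrow> n < b \<Longrightarrow> c \<le> d n"
proof -
  have le: "d m \<le> d n" if "a \<le> m" "m \<le> n" "n < b" for m n
    using that(2,1,3)
  proof (induction n rule: dec_induct)
    case (step n)
    then show ?case using mono[of n] by simp
  qed simp
  define m where "m = (LEAST m. a \<le> m \<and> (m = b \<or> (m < b \<and> c \<le> d m)))"
  have m: "a \<le> m \<and> (m = b \<or> (m < b \<and> c \<le> d m))"
    unfolding m_def by (rule LeastI[of _ b]) (use assms in simp)
  show ?thesis
  proof (rule that[of m])
    show "d n < c" if "a \<le> n" "n < m" for n
      using not_less_Least[of n "\<lambda>m. a \<le> m \<and> (m = b \<or> (m < b \<and> c \<le> d m))"] that m
      unfolding m_def[symmetric] by force
    show "c \<le> d n" if "m \<le> n" "n < b" for n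
      using le[of m n] m that by force
  qed (use m in auto)
qed

text \<open>Telescoping gives \<open>\<mu> * (n - a) \<le> d n - d a \<le> w\<close>. This counts
  the indices whose first difference is too close to a multiple of 2 pi for
  \<open>kusmin_landau\<close>.\<close>

lemma gap_count:
  fixes d :: "nat \<Rightarrow> real"
  assumes "0 < \<mu>" "0 \<le> w"
    and gap: "\<And>n. a \<le> n \<Longrightarrow> Suc n < b \<Longrightarrow> \<mu> \<le> d (Suc n) - d n"
    and lo: "\<And>n. a \<le> n \<Longrightarrow> n < b \<Longrightarrow> l \<le> d n"
    and hi: "\<And>n. a \<le> n \<Longrightarrow> n < b \<Longrightarrow> d n \<le> l + w"
  shows "real (b - a) \<le> w / \<mu> + 1"
proof (cases "a < b")
  case False
  then show ?thesis using assms(1,2) by simp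
next
  case True
  have *: "\<mu> * real (n - a) \<le> d n - d a" if "a \<le> n" "n < b" for n
    using that
  proof (induction n rule: dec_induct)
    case (step n)
    then show ?case using gap[of n] by (simp add: Suc_diff_le algebra_simps)
  qed simp
  have "\<mu> * real (b - 1 - a) \<le> w"
    using *[of "b - 1"] lo[of a] hi[of "b - 1"] True by force
  then have "real (b - 1 - a) \<le> w / \<mu>"
    using assms(1) by (simp add: field_simps)
  then show ?thesis using True by (simp add: of_nat_diff)
qed

lemma norm_sum_cis_le_card: "norm (\<Sum>n=a..<b. cis (f n)) \<le> real (b - a)"
  using norm_sum[of "\<lambda>n. cis (f n)" "{a..<b}"] by simp

lemma norm_sum_split_le:
  fixes z :: "nat \<Rightarrow> complex"
  assumes "a \<le> m" "m \<le> b"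
  shows "norm (\<Sum>n=a..<b. z n) \<le> norm (\<Sum>n=a..<m. z n) + norm (\<Sum>n=m..<b. z n)"
  using norm_triangle_ineq sum.atLeastLessThan_concat[OF assms, of z] by metis

text \<open>The range is cut into three pieces. Near either end of the period there are at most
  \<open>\<theta> / \<mu> + 1\<close> terms, estimated trivially; the middle piece falls under
  \<open>kusmin_landau\<close>. With \<open>\<theta> = sqrt \<mu>\<close> both kinds of contribution
  have order \<open>1 / sqrt \<mu>\<close>.\<close>

lemma exp_sum_one_period:
  fixes f :: "nat \<Rightarrow> real"
  assumes "0 < \<mu>" "\<mu> \<le> 1"
    and gap: "\<And>n. a \<le> n \<Longrightarrow> Suc n < b \<Longrightarrow> \<mu> \<le> f (Suc (Suc n)) - 2 * f (Suc n) + f n"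
    and lo: "\<And>n. a \<le> n \<Longrightarrow> n < b \<Longrightarrow> 2 * pi * of_int k \<le> f (Suc n) - f n"
    and hi: "\<And>n. a \<le> n \<Longrightarrow> n < b \<Longrightarrow> f (Suc n) - f n \<le> 2 * pi * of_int k + 2 * pi"
  shows "norm (\<Sum>n=a..<b. cis (f n)) \<le> 16 / sqrt \<mu>"
proof (cases "a \<le> b")
  case False
  then show ?thesis using assms(1) by simp
next
  case True
  \<comment> \<open>Removing this linear phase leaves every \<open>cis\<close> value unchanged and
    moves the first differences into the interval from 0 to 2 pi.\<close>
  define F where "F n = f n - 2 * pi * of_int (k * int n)" for n
  define d where "d n = F (Suc n) - F n" for n
  define \<theta> where "\<theta> = sqrt \<mu>"
  have \<theta>: "0 < \<theta>" "\<theta> \<le> 1" "\<mu> = \<theta> * \<theta>"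
    using assms(1,2) by (auto simp: \<theta>_def)
  have cis: "cis (F n) = cis (f n)" for n
    using cis_multiple_2pi[of "of_int (k * int n)"]
    by (simp add: F_def cis_divide[symmetric] mult.commute mult.left_commute del: of_int_mult)
  have dd: "d n = f (Suc n) - f n - 2 * pi * of_int k" for n
    by (simp add: d_def F_def algebra_simps)
  have gap': "\<mu> \<le> d (Suc n) - d n" if "a \<le> n" "Suc n < b" for n
    using gap[OF that] by (simp add: dd)
  have mono: "d n \<le> d (Suc n)" if "a \<le> n" "Suc n < b" for n
    using gap'[OF that] assms(1) by simp
  have lo': "0 \<le> d n" and hi': "d n \<le> 2 * pi" if "a \<le> n" "n < b" for n
    using lo[OF that] hi[OF that] by (auto simp: dd)
  obtain p where p: "a \<le> p" "p \<le> b" "\<And>n. a \<le> n \<Longrightarrow> n < p \<Longrightarrow> d n < \<theta>"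
    "\<And>n. p \<le> n \<Longrightarrow> n < b \<Longrightarrow> \<theta> \<le> d n"
    using mono_threshold[OF True, where c = \<theta> and d = d] mono by metis
  have "d n \<le> d (Suc n)" if "p \<le> n" "Suc n < b" for n
    using mono[of n] p(1) that by simp
  then obtain q where q: "p \<le> q" "q \<le> b" "\<And>n. p \<le> n \<Longrightarrow> n < q \<Longrightarrow> d n < 2 * pi - \<theta>"
    "\<And>n. q \<le> n \<Longrightarrow> n < b \<Longrightarrow> 2 * pi - \<theta> \<le> d n"
    using mono_threshold[OF p(2), where c = "2 * pi - \<theta>" and d = d] by metis
  have "real (p - a) \<le> \<theta> / \<mu> + 1"
    by (rule gap_count[where l = 0 and d = d]) (use \<theta> gap' lo' p assms in \<open>auto simp: less_imp_le\<close>)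
  moreover have "real (b - q) \<le> \<theta> / \<mu> + 1"
    by (rule gap_count[where l = "2 * pi - \<theta>" and d = d]) (use \<theta> gap' hi' p q assms in \<open>auto simp: less_imp_le\<close>)
  moreover have "norm (\<Sum>n=p..<q. cis (F n)) \<le> 12 / \<theta>"
  proof (rule kusmin_landau)
    fix n assume n: "p \<le> n"
    show "F (Suc n) - F n \<le> F (Suc (Suc n)) - F (Suc n)" if "Suc n < q"
      using mono[of n] n that p q unfolding d_def by simp
    show "\<theta> \<le> F (Suc n) - F n" if "n < q"
      using p(4)[of n] n that q unfolding d_def by simp
    show "F (Suc n) - F n \<le> 2 * pi - \<theta>" if "n < q"
      using q(3)[of n] n that unfolding d_def by simp
  qed (use \<theta> in simp)
  moreover have "norm (\<Sum>n=a..<b. cis (f n)) \<le>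
      norm (\<Sum>n=a..<p. cis (f n)) + (norm (\<Sum>n=p..<q. cis (f n)) + norm (\<Sum>n=q..<b. cis (f n)))"
    using norm_sum_split_le[OF p(1,2), of "\<lambda>n. cis (f n)"]
      norm_sum_split_le[OF q(1,2), of "\<lambda>n. cis (f n)"] by linarith
  moreover have "norm (\<Sum>n=a..<p. cis (f n)) \<le> real (p - a)"
    "norm (\<Sum>n=q..<b. cis (f n)) \<le> real (b - q)"
    by (rule norm_sum_cis_le_card)+
  moreover have "\<theta> / \<mu> = 1 / \<theta>" "1 \<le> 1 / \<theta>"
    using \<theta> by (auto simp: field_simps)
  ultimately show ?thesis
    unfolding cis \<theta>_def[symmetric] by simp
qed

text \<open>Induction on the number of periods, cutting off the lowest one where the first
  difference reaches \<open>2 * pi * (k + 1)\<close>. The factor \<open>Suc K\<close> allows the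
  base case to cost one full period.\<close>

lemma exp_sum_periods:
  fixes f :: "nat \<Rightarrow> real"
  assumes "0 < \<mu>" "\<mu> \<le> 1"
    and gap: "\<And>n. a \<le> n \<Longrightarrow> Suc n < b \<Longrightarrow> \<mu> \<le> f (Suc (Suc n)) - 2 * f (Suc n) + f n"
    and lo: "\<And>n. a \<le> n \<Longrightarrow> n < b \<Longrightarrow> 2 * pi * of_int k \<le> f (Suc n) - f n"
    and hi: "\<And>n. a \<le> n \<Longrightarrow> n < b \<Longrightarrow> f (Suc n) - f n \<le> 2 * pi * of_int k + 2 * pi * real K"
  shows "norm (\<Sum>n=a..<b. cis (f n)) \<le> real (Suc K) * (16 / sqrt \<mu>)"
  using gap lo hi
proof (induction K arbitrary: a k)
  case 0
  then show ?case
    using exp_sum_one_period[OF assms(1,2), of a b f k] by force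
next
  case (Suc K)
  show ?case
  proof (cases "a \<le> b")
    case False
    then show ?thesis using assms(1) by simp
  next
    case True
    have mono: "f (Suc n) - f n \<le> f (Suc (Suc n)) - f (Suc n)" if "a \<le> n" "Suc n < b" for n
      using Suc.prems(1)[OF that] assms(1) by simp
    obtain m where m: "a \<le> m" "m \<le> b"
      "\<And>n. a \<le> n \<Longrightarrow> n < m \<Longrightarrow> f (Suc n) - f n < 2 * pi * of_int k + 2 * pi"
      "\<And>n. m \<le> n \<Longrightarrow> n < b \<Longrightarrow> 2 * pi * of_int k + 2 * pi \<le> f (Suc n) - f n"
      using mono_threshold[OF True, of "\<lambda>n. f (Suc n) - f n" "2 * pi * of_int k + 2 * pi"] mono by metis
    have "norm (\<Sum>n=a..<m. cis (f n)) \<le> 16 / sqrt \<mu>"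
      by (rule exp_sum_one_period[OF assms(1,2), where k = k]) (use m Suc.prems in \<open>auto simp: less_imp_le\<close>)
    moreover have "norm (\<Sum>n=m..<b. cis (f n)) \<le> real (Suc K) * (16 / sqrt \<mu>)"
    proof (rule Suc.IH[where k = "k + 1"])
      fix n assume n: "m \<le> n"
      show "\<mu> \<le> f (Suc (Suc n)) - 2 * f (Suc n) + f n" if "Suc n < b"
        using Suc.prems(1) n m that by simp
      show "2 * pi * of_int (k + 1) \<le> f (Suc n) - f n" if "n < b"
        using m(4)[OF n that] by (simp add: algebra_simps)
      show "f (Suc n) - f n \<le> 2 * pi * of_int (k + 1) + 2 * pi * real K" if "n < b"
        using Suc.prems(3)[of n] n m that by (simp add: algebra_simps)
    qed
    ultimately show ?thesis
      using norm_sum_split_le[OF m(1,2), of "\<lambda>n. cis (f n)"] by (simp add: algebra_simps add_divide_distrib)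
  qed
qed

text \<open>Over the whole range the first difference grows by at most
  \<open>h * \<mu> * (b - a)\<close>. It therefore meets at most about
  \<open>h * \<mu> * (b - a) / (2 * pi)\<close> periods plus a constant, and each costs
  \<open>16 / sqrt \<mu>\<close>.\<close>

theorem second_difference_test:
  fixes f :: "nat \<Rightarrow> real"
  assumes "0 < \<mu>" "1 \<le> h"
    and lo: "\<And>n. a \<le> n \<Longrightarrow> n < b \<Longrightarrow> \<mu> \<le> f (Suc (Suc n)) - 2 * f (Suc n) + f n"
    and hi: "\<And>n. a \<le> n \<Longrightarrow> n < b \<Longrightarrow> f (Suc (Suc n)) - 2 * f (Suc n) + f n \<le> h * \<mu>"
  shows "norm (\<Sum>n=a..<b. cis (f n)) \<le> 48 * (h * sqrt \<mu> * real (b - a) + 1 / sqrt \<mu>)"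
proof (cases "\<mu> \<le> 1")
  case False
  \<comment> \<open>For \<open>\<mu> > 1\<close> the claimed bound already exceeds the number of
    terms.\<close>
  then have "1 * 1 \<le> h * sqrt \<mu>"
    using assms by (intro mult_mono) auto
  then have "1 * real (b - a) \<le> (h * sqrt \<mu>) * real (b - a)"
    by (intro mult_right_mono) auto
  moreover have "0 \<le> real (b - a)" "0 < 1 / sqrt \<mu>"
    using assms(1) by simp_all
  ultimately show ?thesis
    using norm_sum_cis_le_card[of f a b] by argo
next
  case True
  define N where "N = real (b - a)"
  define d where "d n = f (Suc n) - f n" for n
  define k where "k = \<lfloor>d a / (2 * pi)\<rfloor>"
  \<comment> \<open>The extra period accounts for \<open>d a\<close> starting anywhere inside period
    \<open>k\<close>.\<close>
  define K where "K = nat \<lceil>h * \<mu> * N / (2 * pi)\<rceil> + 1"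
  have k: "2 * pi * of_int k \<le> d a" "d a \<le> 2 * pi * of_int k + 2 * pi"
  proof -
    have "of_int k \<le> d a / (2 * pi)" "d a / (2 * pi) \<le> of_int k + 1"
      unfolding k_def by linarith+
    then show "2 * pi * of_int k \<le> d a" "d a \<le> 2 * pi * of_int k + 2 * pi"
      by (simp_all add: field_simps)
  qed
  have pos: "0 \<le> h * \<mu> * N / (2 * pi)"
    using assms by (simp add: N_def)
  have K: "h * \<mu> * N / (2 * pi) + 1 \<le> real K" "real K \<le> h * \<mu> * N / (2 * pi) + 2"
    using pos unfolding K_def by linarith+
  have "h * \<mu> * N + 2 * pi = 2 * pi * (h * \<mu> * N / (2 * pi) + 1)"
    by (simp add: field_simps)
  also have "\<dots> \<le> 2 * pi * real K"
    by (intro mult_left_mono K) auto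
  finally have K': "h * \<mu> * N + 2 * pi \<le> 2 * pi * real K" .
  have d: "d a \<le> d n \<and> d n \<le> d a + h * \<mu> * real (n - a)" if "a \<le> n" "n < b" for n
    using that
  proof (induction n rule: dec_induct)
    case (step n)
    then show ?case
      using lo[of n] hi[of n] assms(1) by (simp add: d_def Suc_diff_le algebra_simps)
  qed simp
  have "norm (\<Sum>n=a..<b. cis (f n)) \<le> real (Suc K) * (16 / sqrt \<mu>)"
  proof (rule exp_sum_periods[OF assms(1) True, where k = k])
    fix n assume n: "a \<le> n"
    show "\<mu> \<le> f (Suc (Suc n)) - 2 * f (Suc n) + f n" if "Suc n < b"
      using lo n that by simp
    show "2 * pi * of_int k \<le> f (Suc n) - f n" if "n < b"
      using d[OF n that] k unfolding d_def by linarith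
    show "f (Suc n) - f n \<le> 2 * pi * of_int k + 2 * pi * real K" if "n < b"
    proof -
      have "h * \<mu> * real (n - a) \<le> h * \<mu> * N"
        unfolding N_def using that assms by (intro mult_left_mono) auto
      then show ?thesis
        using d[OF n that] k K' unfolding d_def by linarith
    qed
  qed
  also have "\<dots> \<le> (h * \<mu> * N + 3) * (16 / sqrt \<mu>)"
  proof (rule mult_right_mono)
    have "h * \<mu> * N / (2 * pi) \<le> h * \<mu> * N / 1"
      using assms pi_gt3 by (intro divide_left_mono) (auto simp: N_def)
    then show "real (Suc K) \<le> h * \<mu> * N + 3"
      using K by simp
  qed (use assms in simp)
  also have "\<dots> = 16 * h * N * (\<mu> / sqrt \<mu>) + 48 / sqrt \<mu>"
    by (simp add: algebra_simps add_divide_distrib)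
  also have "\<mu> / sqrt \<mu> = sqrt \<mu>"
    using assms(1) by (simp add: real_div_sqrt)
  also have "16 * h * N * sqrt \<mu> \<le> 48 * h * N * sqrt \<mu>"
    using assms by (intro mult_right_mono) (auto simp: N_def)
  finally show ?thesis
    by (simp add: N_def algebra_simps)
qed

subsection \<open>Weyl differencing and the third difference test\<close>

lemma norm_sum_squared_le:
  fixes z :: "'i \<Rightarrow> complex"
  shows "(norm (\<Sum>i\<in>I. z i))\<^sup>2 \<le> real (card I) * (\<Sum>i\<in>I. (norm (z i))\<^sup>2)"
proof -
  have "(norm (\<Sum>i\<in>I. z i))\<^sup>2 \<le> (\<Sum>i\<in>I. norm (z i))\<^sup>2"
    by (intro power_mono norm_sum) auto
  also have "\<dots> \<le> real (card I) * (\<Sum>i\<in>I. (norm (z i))\<^sup>2)"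
    using sum_squared_le_sum_of_squares[of "\<lambda>i. norm (z i)" I]
    by (cases "finite I") (auto simp: mult.commute)
  finally show ?thesis .
qed

text \<open>The argument of \<open>A\<close> is the distance of \<open>l\<close> from
  \<open>j\<close>. Distance 0 occurs once, and every positive distance below \<open>H\<close> at
  most twice, once on each side of \<open>j\<close>.\<close>

lemma sum_abs_diff_le:
  fixes A :: "nat \<Rightarrow> real"
  assumes "j < H" and nonneg: "\<And>r. 0 \<le> A r"
  shows "(\<Sum>l<H. A (if l \<le> j then j - l else l - j)) \<le> A 0 + 2 * (\<Sum>r=1..<H. A r)"
proof -
  let ?A = "\<lambda>l. A (if l \<le> j then j - l else l - j)"
  have "{..<H} = insert j ({..<j} \<union> {Suc j..<H})"
    using assms(1) by auto
  then have "(\<Sum>l<H. ?A l) = A 0 + sum ?A ({..<j} \<union> {Suc j..<H})"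
    by simp
  moreover have "sum ?A ({..<j} \<union> {Suc j..<H}) = sum ?A {..<j} + sum ?A {Suc j..<H}"
    by (rule sum.union_disjoint) auto
  moreover have "sum ?A {..<j} = sum A ((\<lambda>l. j - l) ` {..<j})"
    by (subst sum.reindex) (auto simp: inj_on_def)
  moreover have "\<dots> \<le> sum A {1..<H}"
    using assms by (intro sum_mono2) auto
  moreover have "sum ?A {Suc j..<H} = sum A ((\<lambda>l. l - j) ` {Suc j..<H})"
    by (subst sum.reindex) (auto simp: inj_on_def)
  moreover have "\<dots> \<le> sum A {1..<H}"
    using assms by (intro sum_mono2) auto
  ultimately show ?thesis by linarith
qed

text \<open>\<open>H\<close> times the sum is the total of all sums over windows of length
  \<open>H\<close>. Cauchy-Schwarz over the \<open>N + H\<close> window positions, followed by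
  expanding the squares, leaves correlations that depend only on the lag.\<close>

theorem weyl_van_der_corput:
  fixes z :: "nat \<Rightarrow> complex"
  assumes "0 < H"
  shows "real H * (norm (\<Sum>n<N. z n))\<^sup>2 \<le> real (N + H) *
    (norm (\<Sum>n<N. z n * cnj (z n)) + 2 * (\<Sum>r=1..<H. norm (\<Sum>n<N - r. z (n + r) * cnj (z n))))"
    (is "_ * (norm ?S)\<^sup>2 \<le> _ * ?R")
proof -
  \<comment> \<open>Extending by zero to the integers removes boundary terms from shifts. The set
    \<open>I\<close> contains the start of every window that meets the support.\<close>
  define w where "w n = (if 0 \<le> n \<and> n < int N then z (nat n) else 0)" for n :: int
  define I where "I = {- int H..<int N}"
  define A where "A r = norm (\<Sum>n<N - r. z (n + r) * cnj (z n))" for r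
  have shift: "(\<Sum>k\<in>I. w (k + int j)) = ?S" if "j < H" for j
  proof -
    have "?S = (\<Sum>n<N. w (int n))"
      by (simp add: w_def)
    also have "\<dots> = (\<Sum>k\<in>(\<lambda>n. int n - int j) ` {..<N}. w (k + int j))"
      by (subst sum.reindex) (auto simp: inj_on_def)
    also have "\<dots> = (\<Sum>k\<in>I. w (k + int j))"
    proof (rule sum.mono_neutral_left)
      show "\<forall>i\<in>I - (\<lambda>n. int n - int j) ` {..<N}. w (i + int j) = 0"
      proof
        fix i assume i: "i \<in> I - (\<lambda>n. int n - int j) ` {..<N}"
        have "\<not> (0 \<le> i + int j \<and> i + int j < int N)"
        proof
          assume "0 \<le> i + int j \<and> i + int j < int N"
          then have "i = int (nat (i + int j)) - int j" "nat (i + int j) \<in> {..<N}"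
            by auto
          with i show False by blast
        qed
        then show "w (i + int j) = 0" by (auto simp: w_def)
      qed
    qed (use that in \<open>auto simp: I_def\<close>)
    finally show ?thesis by simp
  qed
  \<comment> \<open>Reindexing by \<open>n = k + l\<close>. For a lag of at least \<open>N\<close>
    the truncated subtraction gives an empty sum, in agreement with the vanishing left side.\<close>
  have corr: "(\<Sum>k\<in>I. w (k + int j) * cnj (w (k + int l))) = (\<Sum>n<N - (j - l). z (n + (j - l)) * cnj (z n))"
    if "l \<le> j" "j < H" for j l
  proof -
    let ?K = "(\<lambda>n. int n - int l) ` {..<N - (j - l)}"
    have "(\<Sum>n<N - (j - l). z (n + (j - l)) * cnj (z n)) = (\<Sum>n<N - (j - l). w (int n - int l + int j) * cnj (w (int n)))"
    proof (rule sum.cong)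
      fix n assume "n \<in> {..<N - (j - l)}"
      then have "z (n + (j - l)) * cnj (z n) = w (int (n + (j - l))) * cnj (w (int n))"
        by (auto simp: w_def simp del: of_nat_add)
      also have "int (n + (j - l)) = int n - int l + int j"
        using that by simp
      finally show "z (n + (j - l)) * cnj (z n) = w (int n - int l + int j) * cnj (w (int n))" .
    qed simp
    also have "\<dots> = (\<Sum>k\<in>?K. w (k + int j) * cnj (w (k + int l)))"
      by (subst sum.reindex) (auto simp: inj_on_def)
    also have "\<dots> = (\<Sum>k\<in>I. w (k + int j) * cnj (w (k + int l)))"
    proof (rule sum.mono_neutral_left)
      show "\<forall>i\<in>I - ?K. w (i + int j) * cnj (w (i + int l)) = 0"
      proof
        fix i assume i: "i \<in> I - ?K"
        have "\<not> (0 \<le> i + int l \<and> i + int j < int N)"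
        proof
          assume "0 \<le> i + int l \<and> i + int j < int N"
          then have "i = int (nat (i + int l)) - int l" "nat (i + int l) \<in> {..<N - (j - l)}"
            using that by auto
          with i show False by blast
        qed
        then show "w (i + int j) * cnj (w (i + int l)) = 0" by (auto simp: w_def)
      qed
    qed (use that in \<open>auto simp: I_def\<close>)
    finally show ?thesis by simp
  qed
  have ncorr: "norm (\<Sum>k\<in>I. w (k + int j) * cnj (w (k + int l))) = A (if l \<le> j then j - l else l - j)"
    if "j < H" "l < H" for j l
  proof (cases "l \<le> j")
    case True
    then show ?thesis using corr that by (simp add: A_def)
  next
    case False
    have "(\<Sum>k\<in>I. w (k + int j) * cnj (w (k + int l))) = cnj (\<Sum>k\<in>I. w (k + int l) * cnj (w (k + int j)))"
      by (simp add: mult.commute)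
    then have "norm (\<Sum>k\<in>I. w (k + int j) * cnj (w (k + int l))) = norm (\<Sum>k\<in>I. w (k + int l) * cnj (w (k + int j)))"
      by (simp only: complex_mod_cnj)
    then show ?thesis using corr[of j l] False that by (simp add: A_def)
  qed
  have sq: "(\<Sum>k\<in>I. (norm (\<Sum>j<H. w (k + int j)))\<^sup>2) \<le> real H * ?R"
  proof -
    define Q where "Q = (\<Sum>k\<in>I. (norm (\<Sum>j<H. w (k + int j)))\<^sup>2)"
    have "0 \<le> Q"
      unfolding Q_def by (intro sum_nonneg) auto
    \<comment> \<open>Passing to the complex numbers turns each squared norm into a product with the
      conjugate, which expands into a double sum over \<open>j\<close> and \<open>l\<close>.\<close>
    have "complex_of_real Q =
        (\<Sum>k\<in>I. \<Sum>j<H. \<Sum>l<H. w (k + int j) * cnj (w (k + int l)))"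
      by (simp add: Q_def complex_norm_square sum_product del: of_real_power)
    also have "\<dots> = (\<Sum>j<H. \<Sum>k\<in>I. \<Sum>l<H. w (k + int j) * cnj (w (k + int l)))"
      by (rule sum.swap)
    also have "\<dots> = (\<Sum>j<H. \<Sum>l<H. \<Sum>k\<in>I. w (k + int j) * cnj (w (k + int l)))"
      by (intro sum.cong refl sum.swap)
    finally have "norm (complex_of_real Q) =
        norm (\<Sum>j<H. \<Sum>l<H. \<Sum>k\<in>I. w (k + int j) * cnj (w (k + int l)))"
      by (rule arg_cong)
    then have "Q = norm (\<Sum>j<H. \<Sum>l<H. \<Sum>k\<in>I. w (k + int j) * cnj (w (k + int l)))"
      using \<open>0 \<le> Q\<close> by (simp only: norm_of_real abs_of_nonneg)
    also have "\<dots> \<le> (\<Sum>j<H. \<Sum>l<H. norm (\<Sum>k\<in>I. w (k + int j) * cnj (w (k + int l))))"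
      by (intro sum_norm_le) auto
    also have "\<dots> = (\<Sum>j<H. \<Sum>l<H. A (if l \<le> j then j - l else l - j))"
      by (intro sum.cong refl ncorr) auto
    also have "\<dots> \<le> (\<Sum>j<H. A 0 + 2 * (\<Sum>r=1..<H. A r))"
      by (intro sum_mono sum_abs_diff_le) (auto simp: A_def)
    finally show ?thesis by (simp add: A_def Q_def)
  qed
  have "of_nat H * ?S = (\<Sum>j<H. \<Sum>k\<in>I. w (k + int j))"
    using shift by simp
  also have "\<dots> = (\<Sum>k\<in>I. \<Sum>j<H. w (k + int j))"
    by (rule sum.swap)
  finally have "(real H)\<^sup>2 * (norm ?S)\<^sup>2 = (norm (\<Sum>k\<in>I. \<Sum>j<H. w (k + int j)))\<^sup>2"
    by (metis norm_mult norm_of_nat power_mult_distrib)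
  also have "\<dots> \<le> real (card I) * (\<Sum>k\<in>I. (norm (\<Sum>j<H. w (k + int j)))\<^sup>2)"
    by (rule norm_sum_squared_le)
  also have "\<dots> \<le> real (card I) * (real H * ?R)"
    by (intro mult_left_mono sq) auto
  also have "card I = N + H"
    by (simp add: I_def nat_add_distrib)
  finally have "real H * (real H * (norm ?S)\<^sup>2) \<le> real H * (real (N + H) * ?R)"
    by (simp only: power2_eq_square mult_ac)
  then show ?thesis
    using assms by (simp only: mult_le_cancel_left_pos of_nat_0_less_iff)
qed

text \<open>The induction step is \<open>1 / x \<le> 2 * (x - y)\<close> with
  \<open>x\<^sup>2 = y\<^sup>2 + 1\<close>, which rearranges to
  \<open>0 \<le> (x - y)\<^sup>2\<close>.\<close>

lemma sum_inverse_sqrt_le: "(\<Sum>r=1..H. 1 / sqrt (real r)) \<le> 2 * sqrt (real H)"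
proof (induction H)
  case (Suc H)
  define x y where "x = sqrt (real (Suc H))" and "y = sqrt (real H)"
  have "x > 0" "x\<^sup>2 = y\<^sup>2 + 1"
    by (auto simp: x_def y_def)
  moreover have "0 \<le> (x - y)\<^sup>2"
    by simp
  ultimately have "1 / x \<le> 2 * x - 2 * y"
    by (simp add: field_simps power2_eq_square)
  then show ?case
    using Suc.IH by (simp add: x_def y_def)
qed simp

text \<open>Weyl differencing with lag \<open>r\<close> produces a phase whose second differences
  lie between \<open>r * \<kappa> ^ 3\<close> and \<open>h * r * \<kappa> ^ 3\<close>, so
  \<open>second_difference_test\<close> applies to every correlation. Writing the lower bound as a
  cube makes \<open>1 / \<kappa>\<close> the natural number of shifts.\<close>

theorem third_difference_test:
  fixes f :: "nat \<Rightarrow> real"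
  assumes "0 < \<kappa>" "1 \<le> h"
    and lo: "\<And>n. n < N \<Longrightarrow> \<kappa> ^ 3 \<le> f (n + 3) - 3 * f (n + 2) + 3 * f (n + 1) - f n"
    and hi: "\<And>n. n < N \<Longrightarrow> f (n + 3) - 3 * f (n + 2) + 3 * f (n + 1) - f n \<le> h * \<kappa> ^ 3"
  shows "(norm (\<Sum>n<N. cis (f n)))\<^sup>2 \<le> 400 * h * ((real N)\<^sup>2 * \<kappa> + real N / \<kappa>)"
proof -
  define S where "S = norm (\<Sum>n<N. cis (f n))"
  \<comment> \<open>With this choice the diagonal contribution, of order
    \<open>N\<^sup>2 / H\<close>, matches the target \<open>N\<^sup>2 * \<kappa>\<close>.\<close>
  define H where "H = nat \<lceil>1 / \<kappa>\<rceil>"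
  have SN: "S \<le> real N"
    using norm_sum_cis_le_card[of f 0 N] by (simp add: S_def lessThan_atLeast0)
  then have SN2: "S\<^sup>2 \<le> (real N)\<^sup>2"
    by (intro power_mono) (auto simp: S_def)
  have h: "X \<le> 400 * h * X" if "0 \<le> X" for X
    using mult_right_mono[of 1 "400 * h" X] that assms(2) by simp
  have pos: "0 \<le> (real N)\<^sup>2 * \<kappa>" "0 \<le> real N / \<kappa>"
    using assms(1) by auto
  \<comment> \<open>In the first two cases the trivial bound \<open>S \<le> N\<close> suffices. In
    the third, \<open>N + H \<le> 2 * N\<close> and rounding up changes \<open>1 / \<kappa>\<close>
    by at most a factor 2.\<close>
  consider "\<kappa> > 1" | "\<kappa> \<le> 1" "N < H" | "\<kappa> \<le> 1" "H \<le> N"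
    by linarith
  then have "S\<^sup>2 \<le> 400 * h * ((real N)\<^sup>2 * \<kappa> + real N / \<kappa>)"
  proof cases
    case 1
    have "(real N)\<^sup>2 * 1 \<le> (real N)\<^sup>2 * \<kappa>"
      using 1 by (intro mult_left_mono) auto
    then have "S\<^sup>2 \<le> (real N)\<^sup>2 * \<kappa> + real N / \<kappa>"
      using SN2 pos by linarith
    also have "\<dots> \<le> 400 * h * \<dots>"
      using pos by (intro h) auto
    finally show ?thesis .
  next
    case 2
    then have "real N \<le> 1 / \<kappa>"
      unfolding H_def by linarith
    then have "real N * real N \<le> real N * (1 / \<kappa>)"
      by (intro mult_left_mono) auto
    then have "S\<^sup>2 \<le> (real N)\<^sup>2 * \<kappa> + real N / \<kappa>"
      using SN2 pos by (simp add: power2_eq_square)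
    also have "\<dots> \<le> 400 * h * \<dots>"
      using pos by (intro h) auto
    finally show ?thesis .
  next
    case 3
    define B where "B = h * \<kappa> * real N + 1 / \<kappa>"
    have "1 \<le> 1 / \<kappa>"
      using 3 assms(1) by simp
    then have H: "1 / \<kappa> \<le> real H" "real H \<le> 2 / \<kappa>" "0 < H"
      unfolding H_def by linarith+
    define q where "q = sqrt (real H * \<kappa>)"
    have "1 \<le> real H * \<kappa>" "real H * \<kappa> \<le> 4"
      using H assms(1) by (auto simp: field_simps)
    then have q: "1 \<le> q" "q \<le> 2"
      using real_sqrt_le_mono[of "real H * \<kappa>" 4] by (auto simp: q_def)
    have corr: "norm (\<Sum>n<N - r. cis (f (n + r)) * cnj (cis (f n))) \<le>
        48 * (2 * h * \<kappa> * real N + 1 / sqrt (\<kappa> ^ 3) * (1 / sqrt (real r)))"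
      if r: "r \<in> {1..<H}" for r
    proof -
      define D where "D n = f (n + 2) - 2 * f (n + 1) + f n" for n
      \<comment> \<open>\<open>D (n + r) - D n\<close> is the second difference of
        \<open>f (n + r) - f n\<close> in \<open>n\<close>, and it telescopes into \<open>r\<close>
        third differences of \<open>f\<close>.\<close>
      have D: "real j * \<kappa> ^ 3 \<le> D (n + j) - D n \<and> D (n + j) - D n \<le> real j * (h * \<kappa> ^ 3)"
        if "n + j \<le> N" for n j
        using that
      proof (induction j)
        case (Suc j)
        have "D (n + Suc j) - D (n + j) = f (n + j + 3) - 3 * f (n + j + 2) + 3 * f (n + j + 1) - f (n + j)"
          by (simp add: D_def numeral_eq_Suc)
        then show ?case
          using Suc lo[of "n + j"] hi[of "n + j"] by (simp add: algebra_simps)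
      qed simp
      have "norm (\<Sum>n=0..<N - r. cis (f (n + r) - f n)) \<le>
          48 * (h * sqrt (real r * \<kappa> ^ 3) * real (N - r - 0) + 1 / sqrt (real r * \<kappa> ^ 3))"
      proof (rule second_difference_test)
        fix n assume "n < N - r"
        then have "real r * \<kappa> ^ 3 \<le> D (n + r) - D n \<and> D (n + r) - D n \<le> real r * (h * \<kappa> ^ 3)"
          by (intro D) auto
        moreover have "f (Suc (Suc n) + r) - f (Suc (Suc n)) - 2 * (f (Suc n + r) - f (Suc n)) + (f (n + r) - f n)
          = D (n + r) - D n"
          by (simp add: D_def)
        ultimately show "real r * \<kappa> ^ 3 \<le> f (Suc (Suc n) + r) - f (Suc (Suc n)) - 2 * (f (Suc n + r) - f (Suc n)) + (f (n + r) - f n)"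
          "f (Suc (Suc n) + r) - f (Suc (Suc n)) - 2 * (f (Suc n + r) - f (Suc n)) + (f (n + r) - f n) \<le> h * (real r * \<kappa> ^ 3)"
          by (simp_all add: algebra_simps)
      qed (use r assms in auto)
      moreover have "h * sqrt (real r * \<kappa> ^ 3) * real (N - r - 0) \<le> h * (2 * \<kappa>) * real N"
      proof -
        have "real r * \<kappa> ^ 3 \<le> real H * \<kappa> ^ 3"
          using r assms(1) by (intro mult_right_mono) auto
        also have "\<dots> = (real H * \<kappa>) * \<kappa>\<^sup>2"
          by (simp add: power3_eq_cube power2_eq_square)
        finally have "sqrt (real r * \<kappa> ^ 3) \<le> sqrt ((real H * \<kappa>) * \<kappa>\<^sup>2)"
          by (rule real_sqrt_le_mono)
        also have "\<dots> = q * \<kappa>"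
          using assms(1) by (simp add: q_def real_sqrt_mult)
        also have "\<dots> \<le> 2 * \<kappa>"
          using q assms(1) by simp
        finally show ?thesis
          using assms by (intro mult_mono) auto
      qed
      moreover have "1 / sqrt (real r * \<kappa> ^ 3) = 1 / sqrt (\<kappa> ^ 3) * (1 / sqrt (real r))"
        by (simp add: real_sqrt_mult)
      ultimately show ?thesis
        by (simp add: cis_cnj cis_mult lessThan_atLeast0 mult.commute mult.left_commute)
    qed
    have "(\<Sum>r=1..<H. norm (\<Sum>n<N - r. cis (f (n + r)) * cnj (cis (f n))))
      \<le> (\<Sum>r=1..<H. 48 * (2 * h * \<kappa> * real N + 1 / sqrt (\<kappa> ^ 3) * (1 / sqrt (real r))))"
      by (intro sum_mono corr)
    also have "\<dots> = 48 * (real (H - 1) * (2 * h * \<kappa> * real N) + 1 / sqrt (\<kappa> ^ 3) * (\<Sum>r=1..<H. 1 / sqrt (real r)))"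
      by (simp only: sum_distrib_left[symmetric] sum.distrib) simp
    also have "\<dots> \<le> 48 * (real H * (2 * h * \<kappa> * real N) + 1 / sqrt (\<kappa> ^ 3) * (2 * sqrt (real H)))"
    proof -
      have "(\<Sum>r=1..<H. 1 / sqrt (real r)) \<le> (\<Sum>r=1..H. 1 / sqrt (real r))"
        by (intro sum_mono2) auto
      then have "(\<Sum>r=1..<H. 1 / sqrt (real r)) \<le> 2 * sqrt (real H)"
        using sum_inverse_sqrt_le[of H] by linarith
      then show ?thesis
        using assms by (intro mult_left_mono add_mono mult_right_mono) auto
    qed
    \<comment> \<open>Inserting the factor \<open>q \<ge> 1\<close> extracts a full
      \<open>H\<close>, which cancels against the left side of the Weyl inequality.\<close>
    also have "1 / sqrt (\<kappa> ^ 3) * (2 * sqrt (real H)) \<le> real H * (2 / \<kappa>)"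
    proof -
      have "sqrt (\<kappa> ^ 3) = \<kappa> * sqrt \<kappa>"
        using assms(1) by (simp add: power3_eq_cube real_sqrt_mult)
      moreover have "sqrt (real H) * 1 \<le> sqrt (real H) * q"
        using q by (intro mult_left_mono) auto
      then have "sqrt (real H) \<le> real H * sqrt \<kappa>"
        by (simp add: q_def real_sqrt_mult mult.assoc[symmetric])
      ultimately show ?thesis
        using assms(1) by (simp add: field_simps)
    qed
    finally have R: "(\<Sum>r=1..<H. norm (\<Sum>n<N - r. cis (f (n + r)) * cnj (cis (f n)))) \<le> 96 * real H * B"
      by (simp add: B_def algebra_simps)
    have "real H * S\<^sup>2 \<le> real (N + H) * (real N + 2 * (96 * real H * B))"
    proof -
      have "real H * S\<^sup>2 \<le> real (N + H) * (norm (\<Sum>n<N. cis (f n) * cnj (cis (f n))) +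
          2 * (\<Sum>r=1..<H. norm (\<Sum>n<N - r. cis (f (n + r)) * cnj (cis (f n)))))"
        unfolding S_def using H(3) by (rule weyl_van_der_corput)
      also have "norm (\<Sum>n<N. cis (f n) * cnj (cis (f n))) = real N"
        by (simp add: cis_cnj cis_mult)
      also have "real (N + H) * (real N + 2 * (\<Sum>r=1..<H. norm (\<Sum>n<N - r. cis (f (n + r)) * cnj (cis (f n)))))
          \<le> real (N + H) * (real N + 2 * (96 * real H * B))"
        by (intro mult_left_mono add_left_mono R) auto
      finally show ?thesis .
    qed
    also have "\<dots> \<le> (2 * real N) * (real H * (\<kappa> * real N) + 2 * (96 * real H * B))"
    proof (rule mult_mono)
      \<comment> \<open>The diagonal term is also given a factor \<open>H\<close>, so that
        \<open>H\<close> can be cancelled throughout.\<close>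
      have "1 * real N \<le> (real H * \<kappa>) * real N"
        using \<open>1 \<le> real H * \<kappa>\<close> by (intro mult_right_mono) auto
      then show "real N + 2 * (96 * real H * B) \<le> real H * (\<kappa> * real N) + 2 * (96 * real H * B)"
        by (simp add: mult.assoc)
      show "0 \<le> real N + 2 * (96 * real H * B)"
        using assms by (simp add: B_def)
    qed (use 3 in auto)
    also have "\<dots> = real H * ((2 * real N) * (\<kappa> * real N + 192 * B))"
      by (simp add: algebra_simps)
    finally have "S\<^sup>2 \<le> (2 * real N) * (\<kappa> * real N + 192 * B)"
      using H(3) by simp
    also have "\<dots> = 2 * ((real N)\<^sup>2 * \<kappa>) + 384 * (h * ((real N)\<^sup>2 * \<kappa>)) + 384 * (real N / \<kappa>)"
      by (simp add: B_def algebra_simps power2_eq_square)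
    also have "\<dots> \<le> 400 * (h * ((real N)\<^sup>2 * \<kappa>)) + 400 * (h * (real N / \<kappa>))"
      using mult_right_mono[OF assms(2) pos(1)] mult_right_mono[OF assms(2) pos(2)] pos by linarith
    finally show ?thesis by (simp add: algebra_simps)
  qed
  then show ?thesis by (simp add: S_def)
qed

subsection \<open>The phase on a dyadic block\<close>

lemma forward_difference_bounds:
  fixes F F' :: "real \<Rightarrow> real"
  assumes "\<And>y. x \<le> y \<Longrightarrow> y \<le> x + 1 \<Longrightarrow> (F has_real_derivative F' y) (at y)"
    and "\<And>y. x \<le> y \<Longrightarrow> y \<le> x + 1 \<Longrightarrow> F' y \<in> {l..u}"
  shows "F (x + 1) - F x \<in> {l..u}"
proof -
  obtain y where "x < y" "y < x + 1" "F (x + 1) - F x = (x + 1 - x) * F' y"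
    using MVT2[of x "x + 1" F F'] assms(1) by auto
  then show ?thesis using assms(2)[of y] by simp
qed

text \<open>The mean value theorem is used twice: the forward difference of \<open>F\<close> has as
  derivative the forward difference of \<open>F1\<close>, which is again controlled by
  \<open>F2\<close>.\<close>

lemma second_difference_bounds:
  fixes F F1 F2 :: "real \<Rightarrow> real"
  assumes F: "\<And>y. x \<le> y \<Longrightarrow> y \<le> x + 2 \<Longrightarrow> (F has_real_derivative F1 y) (at y)"
    and F1: "\<And>y. x \<le> y \<Longrightarrow> y \<le> x + 2 \<Longrightarrow> (F1 has_real_derivative F2 y) (at y)"
    and F2: "\<And>y. x \<le> y \<Longrightarrow> y \<le> x + 2 \<Longrightarrow> F2 y \<in> {l..u}"
  shows "F (x + 2) - 2 * F (x + 1) + F x \<in> {l..u}"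
proof -
  have "(F (x + 1 + 1) - F (x + 1)) - (F (x + 1) - F x) \<in> {l..u}"
  proof (rule forward_difference_bounds[where F = "\<lambda>y. F (y + 1) - F y"])
    fix y assume y: "x \<le> y" "y \<le> x + 1"
    show "((\<lambda>y. F (y + 1) - F y) has_real_derivative F1 (y + 1) - F1 y) (at y)"
      using y F[of y] F[of "y + 1"] by (intro DERIV_diff) (auto simp: DERIV_shift)
    show "F1 (y + 1) - F1 y \<in> {l..u}"
      by (rule forward_difference_bounds[where F' = F2]) (use y in \<open>auto intro!: F1 F2[simplified]\<close>)
  qed
  then show ?thesis by (simp add: add.commute)
qed

lemma third_difference_bounds:
  fixes F F1 F2 F3 :: "real \<Rightarrow> real"
  assumes F: "\<And>y. x \<le> y \<Longrightarrow> y \<le> x + 3 \<Longrightarrow> (F has_real_derivative F1 y) (at y)"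
    and F1: "\<And>y. x \<le> y \<Longrightarrow> y \<le> x + 3 \<Longrightarrow> (F1 has_real_derivative F2 y) (at y)"
    and F2: "\<And>y. x \<le> y \<Longrightarrow> y \<le> x + 3 \<Longrightarrow> (F2 has_real_derivative F3 y) (at y)"
    and F3: "\<And>y. x \<le> y \<Longrightarrow> y \<le> x + 3 \<Longrightarrow> F3 y \<in> {l..u}"
  shows "F (x + 3) - 3 * F (x + 2) + 3 * F (x + 1) - F x \<in> {l..u}"
proof -
  have "(F (x + 2 + 1) - F (x + 2)) - 2 * (F (x + 1 + 1) - F (x + 1)) + (F (x + 1) - F x) \<in> {l..u}"
  proof (rule second_difference_bounds[where F = "\<lambda>y. F (y + 1) - F y"])
    fix y assume y: "x \<le> y" "y \<le> x + 2"
    show "((\<lambda>y. F (y + 1) - F y) has_real_derivative F1 (y + 1) - F1 y) (at y)"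
      using y F[of y] F[of "y + 1"] by (intro DERIV_diff) (auto simp: DERIV_shift)
    show "((\<lambda>y. F1 (y + 1) - F1 y) has_real_derivative F2 (y + 1) - F2 y) (at y)"
      using y F1[of y] F1[of "y + 1"] by (intro DERIV_diff) (auto simp: DERIV_shift)
    show "F2 (y + 1) - F2 y \<in> {l..u}"
      by (rule forward_difference_bounds[where F' = F3]) (use y in \<open>auto intro!: F2 F3[simplified]\<close>)
  qed
  then show ?thesis by (simp add: algebra_simps)
qed

text \<open>In this form the derivatives are differences of pure powers of \<open>x\<close> and
  \<open>x + t\<close>.\<close>

lemma phase_eq: "t * ln (1 + t / x) = t * ln (x + t) - t * ln x" if "0 < x" "0 < t" for x t :: real
proof -
  have "1 + t / x = (x + t) / x"
    using that by (simp add: field_simps)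
  then show ?thesis
    using that by (simp add: ln_div right_diff_distrib)
qed

lemma phase_derivatives:
  fixes x t :: real
  assumes "0 < x" "0 < t"
  shows "((\<lambda>x. t * ln (x + t) - t * ln x) has_real_derivative t / (x + t) - t / x) (at x)"
    and "((\<lambda>x. t / (x + t) - t / x) has_real_derivative t / x ^ 2 - t / (x + t) ^ 2) (at x)"
    and "((\<lambda>x. t / x ^ 2 - t / (x + t) ^ 2) has_real_derivative 2 * t / (x + t) ^ 3 - 2 * t / x ^ 3) (at x)"
proof -
  have nz: "x \<noteq> 0" "x + t \<noteq> 0" using assms by auto
  show "((\<lambda>x. t * ln (x + t) - t * ln x) has_real_derivative t / (x + t) - t / x) (at x)"
    using assms by (auto intro!: derivative_eq_intros)
  show "((\<lambda>x. t / (x + t) - t / x) has_real_derivative t / x ^ 2 - t / (x + t) ^ 2) (at x)"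
    using nz by (auto intro!: derivative_eq_intros simp: power2_eq_square)
  have 1: "((\<lambda>x. t / (x + c) ^ 2) has_real_derivative - 2 * t / (x + c) ^ 3) (at x)" if "x + c \<noteq> 0" for c
  proof -
    have "((\<lambda>u. t / u ^ 2) has_real_derivative - 2 * t / u ^ 3) (at u)" if "u \<noteq> 0" for u
      using that by (auto intro!: derivative_eq_intros simp: power2_eq_square power3_eq_cube mult_ac)
    then show ?thesis
      using that DERIV_shift[of "\<lambda>u. t / u ^ 2" _ x c] by blast
  qed
  show "((\<lambda>x. t / x ^ 2 - t / (x + t) ^ 2) has_real_derivative 2 * t / (x + t) ^ 3 - 2 * t / x ^ 3) (at x)"
    using DERIV_diff[OF 1[of 0] 1[of t]] nz by simp
qed

text \<open>From \<open>x \<le> 4 * N \<le> 4 * t\<close> follows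
  \<open>x + t \<ge> 5/4 * x\<close>, so the subtracted term is at most 16/25, respectively 64/125,
  of the main one. The scales \<open>8 * N\<close> and \<open>5 * N\<close> make the lower bounds a
  constant-free square and cube for the difference tests.\<close>

lemma phase_derivative_bounds:
  fixes x t N :: real
  assumes "0 < N" "N \<le> t" "N \<le> x" "x \<le> 4 * N"
  shows "t / x ^ 2 - t / (x + t) ^ 2 \<in> {t / (8 * N) ^ 2..64 * (t / (8 * N) ^ 2)}"
    and "2 * t / x ^ 3 - 2 * t / (x + t) ^ 3 \<in> {t / (5 * N) ^ 3..250 * (t / (5 * N) ^ 3)}"
proof -
  have pos: "0 < x" "0 < t" and le: "5/4 * x \<le> x + t"
    using assms by auto
  have "t / (x + t) ^ 2 \<le> t / (5/4 * x) ^ 2"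
    using pos le by (intro divide_left_mono power_mono) auto
  also have "\<dots> = 16/25 * (t / x ^ 2)"
    by (simp add: power_mult_distrib power_divide)
  finally have 2: "t / (x + t) ^ 2 \<le> 16/25 * (t / x ^ 2)" .
  have "t / (x + t) ^ 3 \<le> t / (5/4 * x) ^ 3"
    using pos le by (intro divide_left_mono power_mono) auto
  also have "\<dots> = 64/125 * (t / x ^ 3)"
    by (simp add: power_mult_distrib power_divide)
  finally have 3: "t / (x + t) ^ 3 \<le> 64/125 * (t / x ^ 3)" .
  have lo: "t / (4 * N) ^ k \<le> t / x ^ k" and hi: "t / x ^ k \<le> t / N ^ k" for k
    using pos assms by (intro divide_left_mono power_mono; simp)+
  have nonneg: "0 \<le> t / (x + t) ^ k" "0 \<le> t / N ^ k" for k
    using pos assms by auto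
  show "t / x ^ 2 - t / (x + t) ^ 2 \<in> {t / (8 * N) ^ 2..64 * (t / (8 * N) ^ 2)}"
    using 2 lo[of 2] hi[of 2] nonneg[of 2] by (simp add: power_mult_distrib)
  show "2 * t / x ^ 3 - 2 * t / (x + t) ^ 3 \<in> {t / (5 * N) ^ 3..250 * (t / (5 * N) ^ 3)}"
    using 3 lo[of 3] hi[of 3] nonneg[of 3] by (simp add: power_mult_distrib)
qed

text \<open>With \<open>\<mu> = t / (8 * N)\<^sup>2\<close> and \<open>h = 64\<close>, both terms of
  \<open>second_difference_test\<close> are at most \<open>8 * sqrt t\<close>; the term
  \<open>1 / sqrt \<mu>\<close> uses \<open>N \<le> t\<close>.\<close>

lemma phase_sum_second:
  assumes "1 \<le> N" "real N \<le> t" "b \<le> 2 * N"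
  shows "norm (\<Sum>n=N..<b. cis (phase t n)) \<le> 768 * sqrt t"
proof -
  have t: "0 < t" using assms by linarith
  define G where "G x = t * ln (x + t) - t * ln x" for x
  have phase: "phase t n = G (real n)" if "N \<le> n" for n
    unfolding phase_def G_def using that assms t by (intro phase_eq) auto
  define \<mu> where "\<mu> = t / (8 * real N)\<^sup>2"
  have D: "phase t (Suc (Suc n)) - 2 * phase t (Suc n) + phase t n \<in> {\<mu>..64 * \<mu>}"
    if n: "N \<le> n" "n < b" for n
  proof -
    have "G (real n + 2) - 2 * G (real n + 1) + G (real n) \<in> {\<mu>..64 * \<mu>}"
    proof (rule second_difference_bounds)
      fix y assume y: "real n \<le> y" "y \<le> real n + 2"
      \<comment> \<open>The difference reaches at most \<open>2 * N + 1\<close>, which is within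
        \<open>4 * N\<close> since \<open>1 \<le> N\<close>.\<close>
      then have pos: "0 < y" and "real N \<le> y" "y \<le> 4 * real N"
        using n assms by linarith+
      then show "t / y ^ 2 - t / (y + t) ^ 2 \<in> {\<mu>..64 * \<mu>}"
        unfolding \<mu>_def using assms by (intro phase_derivative_bounds) auto
      show "(G has_real_derivative t / (y + t) - t / y) (at y)"
        "((\<lambda>y. t / (y + t) - t / y) has_real_derivative t / y ^ 2 - t / (y + t) ^ 2) (at y)"
        unfolding G_def by (intro phase_derivatives pos t)+
    qed
    then show ?thesis
      using n by (simp add: phase add.commute)
  qed
  have "norm (\<Sum>n=N..<b. cis (phase t n)) \<le> 48 * (64 * sqrt \<mu> * real (b - N) + 1 / sqrt \<mu>)"
    by (rule second_difference_test) (use D assms t in \<open>auto simp: \<mu>_def\<close>)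
  also have "\<dots> \<le> 48 * (8 * sqrt t + 8 * sqrt t)"
  proof (intro mult_left_mono add_mono)
    have s: "sqrt \<mu> = sqrt t / (8 * real N)"
      unfolding \<mu>_def real_sqrt_divide by (simp only: real_sqrt_abs abs_mult abs_numeral abs_of_nat)
    have "64 * sqrt \<mu> * real (b - N) \<le> 64 * sqrt \<mu> * real N"
      using assms t by (intro mult_left_mono) (auto simp: \<mu>_def)
    then show "64 * sqrt \<mu> * real (b - N) \<le> 8 * sqrt t"
      using assms(1) by (simp add: s)
    have "real N / sqrt t \<le> t / sqrt t"
      using assms t by (intro divide_right_mono) auto
    then show "1 / sqrt \<mu> \<le> 8 * sqrt t"
      using t by (simp add: s real_div_sqrt)
  qed simp
  finally show ?thesis by simp
qed

text \<open>Here \<open>s\<close> is the cube root of \<open>t\<close>. The test gives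
  \<open>N\<^sup>2 * \<kappa>\<close> of order \<open>N * s\<close> and \<open>N / \<kappa>\<close>
  of order \<open>N\<^sup>2 / s\<close>; the condition \<open>N \<le> s\<^sup>2\<close> makes the
  first dominate.\<close>

lemma phase_sum_third:
  assumes "1 \<le> N" "real N \<le> t" "b \<le> 2 * N" and s: "0 < s" "s ^ 3 = t" "real N \<le> s\<^sup>2"
  shows "norm (\<Sum>n=N..<b. cis (phase t n)) \<le> 1000 * sqrt (real N * s)"
proof -
  have t: "0 < t" using assms by linarith
  define G where "G x = t * ln (x + t) - t * ln x" for x
  have phase: "phase t n = G (real n)" if "N \<le> n" for n
    unfolding phase_def G_def using that assms t by (intro phase_eq) auto
  define M where "M = b - N"
  define \<kappa> where "\<kappa> = s / (5 * real N)"
  have \<kappa>: "\<kappa> ^ 3 = t / (5 * real N) ^ 3" "0 < \<kappa>"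
    using s assms(1) by (auto simp: \<kappa>_def power_divide)
  \<comment> \<open>The third derivative of the phase is negative, so the test is applied to the
    negated phase. This conjugates the sum and preserves its norm.\<close>
  have D: "- phase t (n + 3 + N) - 3 * - phase t (n + 2 + N) + 3 * - phase t (n + 1 + N) - - phase t (n + N)
      \<in> {\<kappa> ^ 3..250 * \<kappa> ^ 3}" if n: "n < M" for n
  proof -
    define x where "x = real (n + N)"
    have x: "real N \<le> x" "x + 3 \<le> 4 * real N"
      using n assms unfolding M_def x_def by linarith+
    have "- G (x + 3) - 3 * - G (x + 2) + 3 * - G (x + 1) - - G x \<in> {\<kappa> ^ 3..250 * \<kappa> ^ 3}"
      unfolding \<kappa>
    proof (rule third_difference_bounds)
      fix y assume y: "x \<le> y" "y \<le> x + 3"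
      then have pos: "0 < y" using x assms by linarith
      show "((\<lambda>y. - G y) has_real_derivative - (t / (y + t) - t / y)) (at y)"
        unfolding G_def by (intro DERIV_minus phase_derivatives pos t)
      show "((\<lambda>y. - (t / (y + t) - t / y)) has_real_derivative - (t / y ^ 2 - t / (y + t) ^ 2)) (at y)"
        by (intro DERIV_minus phase_derivatives pos t)
      show "((\<lambda>y. - (t / y ^ 2 - t / (y + t) ^ 2)) has_real_derivative - (2 * t / (y + t) ^ 3 - 2 * t / y ^ 3)) (at y)"
        by (intro DERIV_minus phase_derivatives pos t)
      have "2 * t / y ^ 3 - 2 * t / (y + t) ^ 3 \<in> {t / (5 * real N) ^ 3..250 * (t / (5 * real N) ^ 3)}"
        using x y assms by (intro phase_derivative_bounds) auto
      then show "- (2 * t / (y + t) ^ 3 - 2 * t / y ^ 3) \<in> {t / (5 * real N) ^ 3..250 * (t / (5 * real N) ^ 3)}"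
        by simp
    qed
    then show ?thesis
      by (simp add: phase x_def algebra_simps)
  qed
  have "(\<Sum>n=N..<b. cis (phase t n)) = (\<Sum>n<M. cis (phase t (n + N)))"
    unfolding M_def using sum.shift_bounds_nat_ivl[of "\<lambda>n. cis (phase t n)" 0 N "b - N"]
    by (cases "N \<le> b") (auto simp: lessThan_atLeast0)
  also have "\<dots> = cnj (\<Sum>n<M. cis (- phase t (n + N)))"
    by (simp add: cis_cnj)
  finally have "(norm (\<Sum>n=N..<b. cis (phase t n)))\<^sup>2 = (norm (\<Sum>n<M. cis (- phase t (n + N))))\<^sup>2"
    by (simp only: complex_mod_cnj)
  also have "\<dots> \<le> 400 * 250 * ((real M)\<^sup>2 * \<kappa> + real M / \<kappa>)"
    by (rule third_difference_test) (use D \<kappa> in auto)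
  also have "\<dots> \<le> 400 * 250 * (real N * s + 5 * (real N * s))"
  proof (intro mult_left_mono add_mono)
    have M: "real M \<le> real N"
      using assms unfolding M_def by linarith
    then have "(real M)\<^sup>2 * \<kappa> \<le> (real N)\<^sup>2 * \<kappa>"
      using \<kappa> by (intro mult_right_mono power_mono) auto
    also have "\<dots> = real N * s / 5"
      using assms(1) by (simp add: \<kappa>_def power2_eq_square)
    also have "\<dots> \<le> real N * s"
      using s by simp
    finally show "(real M)\<^sup>2 * \<kappa> \<le> real N * s" .
    have "real M / \<kappa> \<le> real N / \<kappa>"
      using M \<kappa> by (intro divide_right_mono) auto
    also have "\<dots> = 5 * (real N * (real N / s))"
      by (simp add: \<kappa>_def)
    also have "\<dots> \<le> 5 * (real N * s)"
      using s by (intro mult_left_mono) (auto simp: field_simps power2_eq_square)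
    finally show "real M / \<kappa> \<le> 5 * (real N * s)" .
  qed simp
  also have "\<dots> \<le> 1000\<^sup>2 * (real N * s)"
    using s by simp
  also have "\<dots> = (1000 * sqrt (real N * s))\<^sup>2"
    using s by (simp add: power_mult_distrib)
  finally show ?thesis
    by (rule power2_le_imp_le) (use s in simp)
qed

subsection \<open>Weights and dyadic decomposition\<close>

text \<open>Summation by parts: the decrements of the weights telescope to \<open>w a - w m\<close>
  at the last index \<open>m\<close>, and the boundary term contributes the remaining
  \<open>w m\<close>.\<close>

lemma abel_bound:
  fixes z :: "nat \<Rightarrow> complex" and w :: "nat \<Rightarrow> real"
  assumes anti: "\<And>n. a \<le> n \<Longrightarrow> Suc n < b \<Longrightarrow> w (Suc n) \<le> w n"
    and nonneg: "\<And>n. a \<le> n \<Longrightarrow> n < b \<Longrightarrow> 0 \<le> w n"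
    and B: "\<And>k. a \<le> k \<Longrightarrow> k \<le> b \<Longrightarrow> norm (\<Sum>n=a..<k. z n) \<le> B"
    and "a < b"
  shows "norm (\<Sum>n=a..<b. complex_of_real (w n) * z n) \<le> w a * B"
proof -
  define Z where "Z k = (\<Sum>n=a..<k. z n)" for k
  define W where "W k = (\<Sum>n=a..<k. complex_of_real (w n) * z n)" for k
  have Suc: "Z (Suc k) = Z k + z k" "W (Suc k) = W k + complex_of_real (w k) * z k" if "a \<le> k" for k
    using that by (auto simp: Z_def W_def)
  have parts: "norm (W (Suc k) - complex_of_real (w k) * Z (Suc k)) \<le> (w a - w k) * B"
    if "a \<le> k" "k < b" for k
    using that
  proof (induction k rule: dec_induct)
    case base
    show ?case by (simp add: W_def Z_def)
  next
    case (step k)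
    have "W (Suc (Suc k)) - complex_of_real (w (Suc k)) * Z (Suc (Suc k)) =
        (W (Suc k) - complex_of_real (w k) * Z (Suc k)) + complex_of_real (w k - w (Suc k)) * Z (Suc k)"
      using step.hyps Suc[of "Suc k"] by (simp add: algebra_simps)
    then have "norm (W (Suc (Suc k)) - complex_of_real (w (Suc k)) * Z (Suc (Suc k))) \<le>
        norm (W (Suc k) - complex_of_real (w k) * Z (Suc k)) + norm (complex_of_real (w k - w (Suc k)) * Z (Suc k))"
      using norm_triangle_ineq by metis
    also have "norm (complex_of_real (w k - w (Suc k)) * Z (Suc k)) \<le> (w k - w (Suc k)) * B"
      unfolding norm_mult norm_of_real using anti[of k] B[of "Suc k"] step
      by (intro mult_mono) (auto simp: Z_def)
    finally show ?case
      using step by (simp add: algebra_simps)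
  qed
  obtain m where m: "b = Suc m" "a \<le> m"
    using \<open>a < b\<close> by (cases b) auto
  have "norm (W b) \<le> norm (W b - complex_of_real (w m) * Z b) + norm (complex_of_real (w m) * Z b)"
    using norm_triangle_ineq[of "W b - complex_of_real (w m) * Z b" "complex_of_real (w m) * Z b"] by simp
  also have "norm (complex_of_real (w m) * Z b) \<le> w m * B"
    unfolding norm_mult norm_of_real using nonneg[of m] B[of b] m
    by (intro mult_mono) (auto simp: Z_def)
  finally show ?thesis
    using parts[of m] m by (simp add: W_def algebra_simps)
qed

text \<open>Induction on \<open>j\<close> over sums below \<open>2 ^ j\<close>, truncated at
  \<open>M\<close>. Each step adds one block starting at a power of two, or nothing once
  \<open>M\<close> has been passed.\<close>

lemma dyadic_sum_bound:
  fixes z :: "nat \<Rightarrow> complex"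
  assumes "0 \<le> B" "M < 2 ^ k"
    and block: "\<And>N b. 1 \<le> N \<Longrightarrow> N \<le> M \<Longrightarrow> b \<le> 2 * N \<Longrightarrow> b \<le> Suc M \<Longrightarrow> norm (\<Sum>n=N..<b. z n) \<le> B"
  shows "norm (\<Sum>n=1..M. z n) \<le> real k * B"
proof -
  have "norm (\<Sum>n=1..<min (2 ^ j) (Suc M). z n) \<le> real j * B" for j
  proof (induction j)
    case (Suc j)
    show ?case
    proof (cases "2 ^ j \<le> M")
      case True
      then have "norm (\<Sum>n=2 ^ j..<min (2 ^ Suc j) (Suc M). z n) \<le> B"
        by (intro block) auto
      moreover have "norm (\<Sum>n=1..<min (2 ^ Suc j) (Suc M). z n) \<le>
        norm (\<Sum>n=1..<2 ^ j. z n) + norm (\<Sum>n=2 ^ j..<min (2 ^ Suc j) (Suc M). z n)"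
        using True by (intro norm_sum_split_le) auto
      moreover have "min (2 ^ j) (Suc M) = 2 ^ j"
        using True by simp
      ultimately show ?thesis
        using Suc.IH by (simp add: algebra_simps)
    next
      case False
      then have "min (2 ^ Suc j) (Suc M) = min (2 ^ j) (Suc M)"
        by simp
      then show ?thesis
        using Suc.IH assms(1) by (simp add: algebra_simps)
    qed
  qed simp
  from this[of k] have "norm (\<Sum>n=1..<Suc M. z n) \<le> real k * B"
    using assms(2) by (simp add: min_absorb2 Suc_leI del: sum.op_ivl_Suc)
  then show ?thesis
    by (simp only: atLeastLessThanSuc_atLeastAtMost)
qed

text \<open>The exponent \<open>e\<close> dominates both claimed exponents, so one statement serves
  all \<sigma>. In terms of \<open>s = t powr (1/3)\<close> they become
  \<open>3/2 - 2 * \<sigma>\<close> and \<open>1 - \<sigma>\<close>, and the breakpoints for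
  \<open>N\<close> are \<open>s\<close> and \<open>s\<^sup>2\<close>.\<close>

lemma phase_block_bound:
  assumes \<sigma>: "0 \<le> \<sigma>" "\<sigma> < 1" and "1 \<le> N" "real N \<le> t" "b \<le> 2 * N"
    and e: "1/2 - 2/3 * \<sigma> \<le> e" "1/3 - 1/3 * \<sigma> \<le> e"
  shows "norm (\<Sum>n=N..<b. complex_of_real (1 / real n powr \<sigma>) * cis (phase t n)) \<le> 1000 * t powr e"
proof (cases "N < b")
  case False
  then show ?thesis by simp
next
  case True
  have t: "1 \<le> t" using assms by linarith
  define x where "x = real N"
  define s where "s = t powr (1/3)"
  have x: "1 \<le> x" using assms by (simp add: x_def)
  have s: "1 \<le> s" "s ^ 3 = t"
    using t by (auto simp: s_def ge_one_powr_ge_zero powr_powr simp flip: powr_numeral)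
  have te: "t powr e = s powr (3 * e)" "sqrt t = s powr (3/2)"
    using t by (auto simp: s_def powr_powr powr_half_sqrt)
  have abel: "norm (\<Sum>n=N..<b. complex_of_real (1 / real n powr \<sigma>) * cis (phase t n)) \<le> x powr - \<sigma> * B"
    if "\<And>k. k \<le> 2 * N \<Longrightarrow> norm (\<Sum>n=N..<k. cis (phase t n)) \<le> B" for B
  proof -
    have "norm (\<Sum>n=N..<b. complex_of_real (1 / real n powr \<sigma>) * cis (phase t n)) \<le> 1 / real N powr \<sigma> * B"
      using assms True that
      by (intro abel_bound) (auto intro!: divide_left_mono powr_mono2)
    then show ?thesis
      by (simp add: x_def powr_minus_divide)
  qed
  consider "x \<le> s" | "s \<le> x" "x \<le> s\<^sup>2" | "s\<^sup>2 \<le> x"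
    by linarith
  then show ?thesis
  proof cases
    case 1
    have "norm (\<Sum>n=N..<k. cis (phase t n)) \<le> x" if "k \<le> 2 * N" for k
      using norm_sum_cis_le_card[of "phase t" N k] that unfolding x_def by linarith
    then have "norm (\<Sum>n=N..<b. complex_of_real (1 / real n powr \<sigma>) * cis (phase t n)) \<le> x powr - \<sigma> * x"
      by (rule abel)
    also have "\<dots> = x powr (1 - \<sigma>)"
      using x by (simp add: powr_diff powr_minus_divide)
    also have "\<dots> \<le> s powr (1 - \<sigma>)"
      using 1 x \<sigma> by (intro powr_mono2) auto
    also have "\<dots> \<le> s powr (3 * e)"
      using s e by (intro powr_mono) auto
    also have "\<dots> \<le> 1000 * t powr e"
      by (simp add: te)
    finally show ?thesis .
  next
    case 2
    have "norm (\<Sum>n=N..<b. complex_of_real (1 / real n powr \<sigma>) * cis (phase t n)) \<le>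
        x powr - \<sigma> * (1000 * sqrt (x * s))"
      unfolding x_def[symmetric]
      by (rule abel) (use 2 s assms phase_sum_third[of N t _ s] in \<open>auto simp: x_def\<close>)
    also have "\<dots> = 1000 * (x powr (1/2 - \<sigma>) * s powr (1/2))"
      using x s by (simp add: powr_diff powr_minus_divide powr_half_sqrt real_sqrt_mult)
    also have "x powr (1/2 - \<sigma>) * s powr (1/2) \<le> s powr (3 * e)"
    \<comment> \<open>The sign of \<open>1/2 - \<sigma>\<close> decides which end of the range is
      worst: \<open>x = s\<^sup>2\<close> when the power of \<open>x\<close> increases,
      \<open>x = s\<close> when it decreases.\<close>
    proof (cases "\<sigma> \<le> 1/2")
      case True
      have "x powr (1/2 - \<sigma>) \<le> (s powr 2) powr (1/2 - \<sigma>)"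
        using 2 x s True by (intro powr_mono2) auto
      then have "x powr (1/2 - \<sigma>) * s powr (1/2) \<le> s powr (2 * (1/2 - \<sigma>)) * s powr (1/2)"
        by (intro mult_right_mono) (auto simp: powr_powr)
      also have "\<dots> = s powr (3/2 - 2 * \<sigma>)"
        by (simp add: algebra_simps flip: powr_add)
      also have "\<dots> \<le> s powr (3 * e)"
        using s e by (intro powr_mono) auto
      finally show ?thesis .
    next
      case False
      have "x powr (1/2 - \<sigma>) \<le> s powr (1/2 - \<sigma>)"
        using 2 s False by (intro powr_mono2') auto
      then have "x powr (1/2 - \<sigma>) * s powr (1/2) \<le> s powr (1/2 - \<sigma>) * s powr (1/2)"
        by (intro mult_right_mono) auto
      also have "\<dots> = s powr (1 - \<sigma>)"
        by (simp add: algebra_simps flip: powr_add)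
      also have "\<dots> \<le> s powr (3 * e)"
        using s e by (intro powr_mono) auto
      finally show ?thesis .
    qed
    finally show ?thesis by (simp add: te)
  next
    case 3
    have "norm (\<Sum>n=N..<b. complex_of_real (1 / real n powr \<sigma>) * cis (phase t n)) \<le>
        x powr - \<sigma> * (768 * sqrt t)"
      by (rule abel) (use assms in \<open>auto intro: phase_sum_second\<close>)
    also have "x powr - \<sigma> \<le> (s powr 2) powr - \<sigma>"
      using 3 s \<sigma> by (intro powr_mono2') auto
    also have "(s powr 2) powr - \<sigma> * (768 * sqrt t) = 768 * s powr (3/2 - 2 * \<sigma>)"
      by (simp add: te powr_powr algebra_simps flip: powr_add)
    also have "\<dots> \<le> 1000 * s powr (3 * e)"
      using s e by (intro mult_mono powr_mono) auto
    finally show ?thesis using t by (simp add: te mult_right_mono)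
  qed
qed

theorem lemma2p2:
  fixes \<sigma> :: real
  assumes "0 \<le> \<sigma>" and "\<sigma> < 1"
  shows "(\<lambda>t::real. \<Sum>m = 1..nat \<lfloor>t\<rfloor>.
            complex_of_real (1 / real m powr \<sigma>) * exp (\<i> * complex_of_real (phase t m)))
         \<in> O[at_top](\<lambda>t. complex_of_real
              (if \<sigma> \<le> 1/2 then t powr (1/2 - 2/3 * \<sigma>) * ln t
               else t powr (1/3 - 1/3 * \<sigma>) * ln t))"
proof -
  \<comment> \<open>This is the maximum of the two exponents, which agree at
    \<open>\<sigma> = 1/2\<close>.\<close>
  define e where "e = (if \<sigma> \<le> 1/2 then 1/2 - 2/3 * \<sigma> else 1/3 - 1/3 * \<sigma>)"
  have e: "1/2 - 2/3 * \<sigma> \<le> e" "1/3 - 1/3 * \<sigma> \<le> e"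
    by (auto simp: e_def)
  have bound: "norm (\<Sum>m = 1..nat \<lfloor>t\<rfloor>. complex_of_real (1 / real m powr \<sigma>) * exp (\<i> * complex_of_real (phase t m)))
      \<le> 6000 * norm (complex_of_real (t powr e * ln t))" if t: "2 \<le> t" for t
  proof -
    define k where "k = nat \<lfloor>log 2 t\<rfloor> + 1"
    have "0 \<le> log 2 t"
      using t by simp
    then have k: "log 2 t < real k" "real k \<le> log 2 t + 1"
      unfolding k_def by linarith+
    have "t = 2 powr (log 2 t)"
      using t by simp
    also have "\<dots> < 2 powr real k"
      using k by (intro powr_less_mono) auto
    finally have "t < 2 ^ k"
      by (simp add: powr_realpow)
    moreover have "real (nat \<lfloor>t\<rfloor>) \<le> t"
      using t by (intro of_nat_floor) auto
    ultimately have "real (nat \<lfloor>t\<rfloor>) < real (2 ^ k)"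
      by (simp only: of_nat_power of_nat_numeral)
    then have "nat \<lfloor>t\<rfloor> < 2 ^ k"
      by (simp only: of_nat_less_iff)
    then have "norm (\<Sum>m = 1..nat \<lfloor>t\<rfloor>. complex_of_real (1 / real m powr \<sigma>) * cis (phase t m))
        \<le> real k * (1000 * t powr e)"
    proof (intro dyadic_sum_bound)
      fix N b assume N: "1 \<le> N" "N \<le> nat \<lfloor>t\<rfloor>" "b \<le> 2 * N"
      have "real N \<le> t"
        using N t by linarith
      then show "norm (\<Sum>n=N..<b. complex_of_real (1 / real n powr \<sigma>) * cis (phase t n)) \<le> 1000 * t powr e"
        using N by (intro phase_block_bound assms e)
    qed auto
    also have "\<dots> \<le> (6 * ln t) * (1000 * t powr e)"
    proof (rule mult_right_mono)
      \<comment> \<open>Since \<open>ln 2 \<ge> 2/3\<close>, both \<open>log 2 t\<close> and 1 are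
        at most \<open>3/2 * ln t\<close>, which bounds the number of blocks \<open>k\<close> by a
        multiple of \<open>ln t\<close>.\<close>
      have "ln t \<ge> ln 2"
        using t by simp
      then have ln: "ln t \<ge> 2/3"
        using ln2_ge_two_thirds by linarith
      have "log 2 t \<le> ln t / (2/3)"
        unfolding log_def using ln ln2_ge_two_thirds by (intro divide_left_mono) auto
      then show "real k \<le> 6 * ln t"
        using k ln by simp
    qed simp
    also have "\<dots> = 6000 * norm (complex_of_real (t powr e * ln t))"
      using t by (simp add: norm_mult)
    finally show ?thesis
      by (simp add: cis_conv_exp)
  qed
  have "(\<lambda>t. \<Sum>m = 1..nat \<lfloor>t\<rfloor>. complex_of_real (1 / real m powr \<sigma>) * exp (\<i> * complex_of_real (phase t m)))
      \<in> O[at_top](\<lambda>t. complex_of_real (t powr e * ln t))"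
    by (rule bigoI[where c = 6000], rule eventually_mono[OF eventually_ge_at_top[of 2]], rule bound)
  also have "(\<lambda>t. complex_of_real (t powr e * ln t)) = (\<lambda>t. complex_of_real
              (if \<sigma> \<le> 1/2 then t powr (1/2 - 2/3 * \<sigma>) * ln t
               else t powr (1/3 - 1/3 * \<sigma>) * ln t))"
    by (auto simp: e_def)
  finally show ?thesis .
qed

end
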